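(* The following two statements hold. (i) Let $\mathbb{D}$ be a semi-single-peaked domain on a tree $\mathcal{T}^A$. Then $\mathbb{D}\nsubseteq\mathbb{D}_{\mathrm{SP}}(\mathcal{T}^A)$ if and only if there exists a critical spot $(x,y)$ in $\mathcal{T}^A$. (ii) Let $\mathbb{D}$ be an $(a,b)$-semi-hybrid domain on a tree $\mathcal{T}^A$. Then $\mathbb{D}\nsubseteq\mathbb{D}_{\mathrm{H}}(\mathcal{T}^A,a,b)$ if and only if there exists a critical spot $(x,y)$ in $\mathcal{T}^A$ such that either $x,y\in A^{a\rightharpoonup b}\setminus\{a\}$ or $x,y\in A^{b\rightharpoonup a}\setminus\{b\}$.
   Context: $A$ is a finite set of alternatives, $|A|=m\ge 3$. A preference is a linear order $P_i$ on $A$; $r_k(P_i)$ is its $k$-th ranked alternative, $r_1(P_i)$ its peak, $\max^{P_i}(B)$ the $P_i$-best element of $B\subseteq A$. A domain $\mathbb{D}$ is a set of preferences. Alternatives $a\ne b$ are adjacent ($a\sim b$) in $\mathbb{D}$ if there are $P_i,P_i'\in\mathbb{D}$ with $r_1(P_i)=r_2(P_i')=a$, $r_1(P_i')=r_2(P_i)=b$, $r_k(P_i)=r_k(P_i')$ for $k\ge3$. The adjacency graph $G_\sim^A$ has vertex set $A$ and edges the adjacent pairs; $G_\sim^B$ is the induced subgraph on $B\subseteq A$. $\mathrm{Leaf}(G)$ is the set of vertices with exactly one neighbor in a graph $G$. **Trees.** $\mathcal{T}^A$ denotes a tree with vertex set $A$; $\langle x,y|\mathcal{T}^A\rangle$ is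 the unique path between $x$ and $y$ (also its vertex set). For a path (or subtree) with vertex set $B$, the projection $\mathrm{Proj}(a,\cdot)$ of $a$ on it is $a$ if $a\in B$, and otherwise the unique $a'\in B$ lying on $\langle a,b|\mathcal{T}^A\rangle$ for all $b\in B$. For $x\ne y$, $A^{x\rightharpoonup y}=\{z\in A: x\in\langle z,y|\mathcal{T}^A\rangle\}$. Distinct $a,b$ are dual-thresholds in $\mathcal{T}^A$ if $\mathrm{Proj}(c,\langle a,b|\mathcal{T}^A\rangle)\in\{a,b\}$ for all $c\in A\setminus\langle a,b|\mathcal{T}^A\rangle$. **Single-peaked.** $\mathbb{D}_{\mathrm{SP}}(\mathcal{T}^A)$ is the set of all preferences $P_i$ such that for all distinct $a,b\in A$, $a\in\langle r_1(P_i),b|\mathcal{T}^A\rangle$ implies $a\mathrel{P_i}b$. **Hybrid.** For dual-thresholds $a,b$, $\mathbb{D}_{\mathrm{H}}(\mathcal{T}^A,a,b)$ is the set of all preferences $P_i$ such that (1) for all distinct $y,z\in A^{a\rightharpoonup b}$ or $y,z\in A^{b\rightharpoonup a}$, $y\in\langle r_1(P_i),z|\mathcal{T}^A\rangle$ implies $y\mathrel{P_i}z$; (2) $r_1(P_i)\in A^{a\rightharpoonup b}\setminus\{a\}$ implies $\max^{P_i}(\langle a,b|\mathcal{T}^A\rangle)=a$, and $r_1(P_i)\in A^{b\rightharpoonup a}\setminus\{b\}$ implies $\max^{P_i}(\langle a,b|\mathcal{T}^A\rangle)=b$. **Semi-single-peaked.** $P_i$ is semi-single-peaked on $\mathcal{T}^A$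 w.r.t. $\bar{x}\in A$ if (1) for distinct $a,b\in\langle r_1(P_i),\bar{x}|\mathcal{T}^A\rangle$, $a\in\langle r_1(P_i),b|\mathcal{T}^A\rangle$ implies $a\mathrel{P_i}b$; and (2) for $a\notin\langle r_1(P_i),\bar{x}|\mathcal{T}^A\rangle$ with projection $a'$ on that path, $a'\mathrel{P_i}a$. $\mathbb{D}_{\mathrm{SSP}}(\mathcal{T}^A,\bar{x})$ is the set of all such preferences. $\mathbb{D}$ is a semi-single-peaked domain on $\mathcal{T}^A$ if $\mathbb{D}\subseteq\mathbb{D}_{\mathrm{SSP}}(\mathcal{T}^A,\bar{x})$ for some $\bar x\in A$, and $G_\sim^A$ is connected. **Semi-hybrid.** Given dual-thresholds $a,b$ in $\mathcal{T}^A$, $P_i$ is $(a,b)$-semi-hybrid on $\mathcal{T}^A$ if: (1) if $r_1(P_i)\in A^{a\rightharpoonup b}\setminus\{a\}$, then $P_i$ is semi-single-peaked on $\mathcal{T}^A$ w.r.t. $a$ and $\max^{P_i}(A^{b\rightharpoonup a})=b$; (2) if $r_1(P_i)\in A^{b\rightharpoonup a}\setminus\{b\}$, then $P_i$ is semi-single-peaked on $\mathcal{T}^A$ w.r.t. $b$ and $\max^{P_i}(A^{a\rightharpoonup b})=a$; (3) if $r_1(P_i)\in\langle a,b|\mathcal{T}^A\rangle$, then $\max^{P_i}(A^{a\rightharpoonup b})=a$ and $\max^{P_i}(A^{b\rightharpoonup a})=b$. $\mathbb{D}_{\mathrm{SH}}(\mathcal{T}^A,a,b)$ is the set of all such preferences.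 $\mathbb{D}$ is an $(a,b)$-semi-hybrid domain on $\mathcal{T}^A$ ($a,b$ dual-thresholds in $\mathcal{T}^A$) if: (i) $\mathbb{D}\subseteq\mathbb{D}_{\mathrm{SH}}(\mathcal{T}^A,a,b)$ and $G_\sim^A$ is connected; (ii) there are no tree $\widehat{\mathcal{T}}^A$ and dual-thresholds $\hat a,\hat b$ in it with $\mathbb{D}\subseteq\mathbb{D}_{\mathrm{SH}}(\widehat{\mathcal{T}}^A,\hat a,\hat b)$ and $\langle\hat a,\hat b|\widehat{\mathcal{T}}^A\rangle\subsetneq\langle a,b|\mathcal{T}^A\rangle$ as vertex sets; (iii) if $G_\sim^A$ is a tree, then for each $x\in\mathrm{Leaf}(G_\sim^{\langle a,b|\mathcal{T}^A\rangle})$ some $P_i\in\mathbb{D}$ is not semi-single-peaked on $G_\sim^A$ w.r.t. $x$. **Critical spot.** Given a domain $\mathbb{D}$ and a tree $\mathcal{T}^A$, an (ordered) edge $(x,y)$ of $\mathcal{T}^A$ is a critical spot in $\mathcal{T}^A$ if: (i) every $P_i\in\mathbb{D}$ with $r_1(P_i)\in A^{x\rightharpoonup y}$ is semi-single-peaked on $\mathcal{T}^A$ w.r.t. $y$; (ii) every $P_i\in\mathbb{D}$ with $r_1(P_i)\in A^{y\rightharpoonup x}$ satisfies $\max^{P_i}(A^{x\rightharpoonup y})=x$; (iii) there are $P_i,P_i'\in\mathbb{D}$ with $r_1(P_i)=r_1(P_i')\in A^{y\rightharpoonup x}$, $y\mathrel{P_i}x$ and $x\mathrel{P_i'}y$.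 *)

theory Defs
  imports "HOL-Library.Cardinality"
begin

text \<open>
  The alternatives are the elements of a finite type. A graph always has all alternatives as
  vertices and is given by its set of edges, a symmetric irreflexive relation.
\<close>

type_synonym 'a graph = "('a \<times> 'a) set"

definition simple_graph :: "'a graph \<Rightarrow> bool" where
  "simple_graph G \<longleftrightarrow> sym G \<and> irrefl G"

definition connected_graph :: "'a graph \<Rightarrow> bool" where
  "connected_graph G \<longleftrightarrow> (\<forall>u v. (u, v) \<in> G\<^sup>*)"

definition cycle :: "'a graph \<Rightarrow> 'a list \<Rightarrow> bool" where
  "cycle G p \<longleftrightarrow>
     3 \<le> length p \<and> distinct p \<and> successively (\<lambda>u v. (u, v) \<in> G) p \<and> (last p, hd p) \<in> G"

definition tree :: "'a graph \<Rightarrow> bool" where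
  "tree G \<longleftrightarrow> simple_graph G \<and> connected_graph G \<and> (\<nexists>p. cycle G p)"

definition path_between :: "'a graph \<Rightarrow> 'a \<Rightarrow> 'a \<Rightarrow> 'a list \<Rightarrow> bool" where
  "path_between G x y p \<longleftrightarrow>
     p \<noteq> [] \<and> hd p = x \<and> last p = y \<and> distinct p \<and> successively (\<lambda>u v. (u, v) \<in> G) p"

text \<open>The vertex set of the path between two vertices; only meaningful in a tree.\<close>

definition tree_path :: "'a graph \<Rightarrow> 'a \<Rightarrow> 'a \<Rightarrow> 'a set" where
  "tree_path T x y = set (THE p. path_between T x y p)"

text \<open>The vertices outside \<open>B\<close> are kept as isolated vertices; they are never leaves.\<close>

definition induced_subgraph :: "'a graph \<Rightarrow> 'a set \<Rightarrow> 'a graph" where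
  "induced_subgraph G B = G \<inter> B \<times> B"

definition leaves :: "'a graph \<Rightarrow> 'a set" where
  "leaves G = {v. \<exists>!w. (v, w) \<in> G}"

text \<open>Only meaningful if \<open>B\<close> is the vertex set of a path (or subtree) of the tree \<open>T\<close>.\<close>

definition proj :: "'a graph \<Rightarrow> 'a \<Rightarrow> 'a set \<Rightarrow> 'a" where
  "proj T a B = (if a \<in> B then a else (THE a'. a' \<in> B \<and> (\<forall>b\<in>B. a' \<in> tree_path T a b)))"

text \<open>\<open>side T x y\<close> is the set $A^{x\rightharpoonup y}$.\<close>

definition side :: "'a graph \<Rightarrow> 'a \<Rightarrow> 'a \<Rightarrow> 'a set" where
  "side T x y = {z. x \<in> tree_path T z y}"

definition dual_thresholds :: "'a graph \<Rightarrow> 'a \<Rightarrow> 'a \<Rightarrow> bool" where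
  "dual_thresholds T a b \<longleftrightarrow>
     a \<noteq> b \<and> (\<forall>c. c \<notin> tree_path T a b \<longrightarrow> proj T c (tree_path T a b) \<in> {a, b})"

text \<open>
  A preference is a (reflexive) linear order \<open>P\<close>, where \<open>(a, b) \<in> P\<close> means that \<open>a\<close> is at least
  as good as \<open>b\<close>; for distinct \<open>a\<close> and \<open>b\<close> this is strict preference.
\<close>

type_synonym 'a preference = "('a \<times> 'a) set"

definition ranked :: "nat \<Rightarrow> 'a preference \<Rightarrow> 'a" where
  "ranked k P = (THE x. card {y. (y, x) \<in> P} = k)"

abbreviation peak :: "'a preference \<Rightarrow> 'a" where
  "peak P \<equiv> ranked 1 P"

definition best :: "'a preference \<Rightarrow> 'a set \<Rightarrow> 'a" where
  "best P B = (THE x. x \<in> B \<and> (\<forall>y\<in>B. (x, y) \<in> P))"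

definition adjacency_graph :: "'a preference set \<Rightarrow> 'a graph" where
  "adjacency_graph D = {(a, b). a \<noteq> b \<and> (\<exists>P\<in>D. \<exists>P'\<in>D.
     ranked 1 P = a \<and> ranked 2 P' = a \<and> ranked 1 P' = b \<and> ranked 2 P = b \<and>
     (\<forall>k\<in>{3..CARD('a)}. ranked k P = ranked k P'))}"

definition single_peaked_prefs :: "'a graph \<Rightarrow> 'a preference set" where
  "single_peaked_prefs T = {P. linear_order P \<and>
     (\<forall>a b. a \<noteq> b \<longrightarrow> a \<in> tree_path T (peak P) b \<longrightarrow> (a, b) \<in> P)}"

definition hybrid_prefs :: "'a graph \<Rightarrow> 'a \<Rightarrow> 'a \<Rightarrow> 'a preference set" where
  "hybrid_prefs T a b = {P. linear_order P \<and>
     (\<forall>y z. y \<noteq> z \<longrightarrow>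
        (y \<in> side T a b \<and> z \<in> side T a b) \<or> (y \<in> side T b a \<and> z \<in> side T b a) \<longrightarrow>
        y \<in> tree_path T (peak P) z \<longrightarrow> (y, z) \<in> P) \<and>
     (peak P \<in> side T a b - {a} \<longrightarrow> best P (tree_path T a b) = a) \<and>
     (peak P \<in> side T b a - {b} \<longrightarrow> best P (tree_path T a b) = b)}"

definition semi_single_peaked :: "'a graph \<Rightarrow> 'a \<Rightarrow> 'a preference \<Rightarrow> bool" where
  "semi_single_peaked T xbar P \<longleftrightarrow>
     (\<forall>a\<in>tree_path T (peak P) xbar. \<forall>b\<in>tree_path T (peak P) xbar.
        a \<noteq> b \<longrightarrow> a \<in> tree_path T (peak P) b \<longrightarrow> (a, b) \<in> P) \<and>
     (\<forall>a. a \<notin> tree_path T (peak P) xbar \<longrightarrow> (proj T a (tree_path T (peak P) xbar), a) \<in> P)"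

definition semi_single_peaked_prefs :: "'a graph \<Rightarrow> 'a \<Rightarrow> 'a preference set" where
  "semi_single_peaked_prefs T xbar = {P. linear_order P \<and> semi_single_peaked T xbar P}"

definition semi_single_peaked_domain :: "'a graph \<Rightarrow> 'a preference set \<Rightarrow> bool" where
  "semi_single_peaked_domain T D \<longleftrightarrow>
     (\<exists>xbar. D \<subseteq> semi_single_peaked_prefs T xbar) \<and> connected_graph (adjacency_graph D)"

definition semi_hybrid :: "'a graph \<Rightarrow> 'a \<Rightarrow> 'a \<Rightarrow> 'a preference \<Rightarrow> bool" where
  "semi_hybrid T a b P \<longleftrightarrow>
     (peak P \<in> side T a b - {a} \<longrightarrow>
        semi_single_peaked T a P \<and> best P (side T b a) = b) \<and>
     (peak P \<in> side T b a - {b} \<longrightarrow>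
        semi_single_peaked T b P \<and> best P (side T a b) = a) \<and>
     (peak P \<in> tree_path T a b \<longrightarrow>
        best P (side T a b) = a \<and> best P (side T b a) = b)"

definition semi_hybrid_prefs :: "'a graph \<Rightarrow> 'a \<Rightarrow> 'a \<Rightarrow> 'a preference set" where
  "semi_hybrid_prefs T a b = {P. linear_order P \<and> semi_hybrid T a b P}"

definition semi_hybrid_domain ::
  "'a graph \<Rightarrow> 'a \<Rightarrow> 'a \<Rightarrow> 'a preference set \<Rightarrow> bool" where
  "semi_hybrid_domain T a b D \<longleftrightarrow>
     dual_thresholds T a b \<and>
     D \<subseteq> semi_hybrid_prefs T a b \<and> connected_graph (adjacency_graph D) \<and>
     \<not> (\<exists>T' a' b'. tree T' \<and> dual_thresholds T' a' b' \<and>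
          D \<subseteq> semi_hybrid_prefs T' a' b' \<and> tree_path T' a' b' \<subset> tree_path T a b) \<and>
     (tree (adjacency_graph D) \<longrightarrow>
       (\<forall>x\<in>leaves (induced_subgraph (adjacency_graph D) (tree_path T a b)).
          \<exists>P\<in>D. \<not> semi_single_peaked (adjacency_graph D) x P))"

definition critical_spot :: "'a preference set \<Rightarrow> 'a graph \<Rightarrow> 'a \<Rightarrow> 'a \<Rightarrow> bool" where
  "critical_spot D T x y \<longleftrightarrow>
     (x, y) \<in> T \<and>
     (\<forall>P\<in>D. peak P \<in> side T x y \<longrightarrow> semi_single_peaked T y P) \<and>
     (\<forall>P\<in>D. peak P \<in> side T y x \<longrightarrow> best P (side T x y) = x) \<and>
     (\<exists>P\<in>D. \<exists>P'\<in>D. peak P = peak P' \<and> peak P \<in> side T y x \<and> (y, x) \<in> P \<and> (x, y) \<in> P')"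

end

theory Submission
  imports Defs
begin

text \<open>
  Both parts follow from one statement about a set \<open>B\<close> of alternatives attached to the rest of
  the tree through a single vertex \<open>c\<close>: in part (i), \<open>B\<close> is everything and \<open>c\<close> is the alternative
  \<open>xbar\<close>; in part (ii), \<open>c\<close> is a threshold and \<open>B\<close> its side. A failure of single-peakedness inside
  \<open>B\<close> yields an edge \<open>(x, y)\<close> of the tree, with \<open>y\<close> nearer to \<open>c\<close>, such that some preference with
  peak on the side of \<open>y\<close> ranks \<open>x\<close> above \<open>y\<close>. Such an edge whose side of \<open>x\<close> is smallest is a
  critical spot. A violation of condition (ii) of critical spots would produce such an edge farther
  out. If condition (iii) failed, the peaks on the side of \<open>y\<close> of preferences ranking \<open>x\<close> above \<open>y\<close>
  would form a nonempty set closed under adjacency, hence contain \<open>y\<close>, which is absurd.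
\<close>

section \<open>Linear orders on a finite type\<close>

lemma linear_orderD:
  assumes "linear_order P"
  shows "(x, x) \<in> P"
    and "(x, y) \<in> P \<Longrightarrow> (y, z) \<in> P \<Longrightarrow> (x, z) \<in> P"
    and "(x, y) \<in> P \<Longrightarrow> (y, x) \<in> P \<Longrightarrow> x = y"
    and "(x, y) \<notin> P \<Longrightarrow> (y, x) \<in> P"
  using assms
  unfolding linear_order_on_def partial_order_on_def preorder_on_def total_on_def
    trans_def antisym_def refl_on_def
  by (blast, blast, blast, metis UNIV_I)

text \<open>Inverse to \<open>\<lambda>k. ranked k P\<close> for a linear order on a finite type; it
  turns the definite description in \<open>ranked\<close> into arithmetic on positions counted from
  1.\<close>

definition rank :: "'a preference \<Rightarrow> 'a \<Rightarrow> nat" where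
  "rank P x = card {y. (y, x) \<in> P}"

text \<open>The sets of alternatives weakly above a given one form a chain under inclusion, and a
  proper inclusion of finite sets lowers the cardinality.\<close>

lemma rank_le_iff:
  fixes P :: "'a::finite preference"
  assumes "linear_order P"
  shows "rank P x \<le> rank P y \<longleftrightarrow> (x, y) \<in> P"
proof
  note lo = linear_orderD[OF assms]
  show "(x, y) \<in> P \<Longrightarrow> rank P x \<le> rank P y"
    unfolding rank_def by (rule card_mono) (auto intro: lo)
  assume le: "rank P x \<le> rank P y"
  show "(x, y) \<in> P"
  proof (rule ccontr)
    assume n: "(x, y) \<notin> P"
    then have "{z. (z, y) \<in> P} \<subset> {z. (z, x) \<in> P}"
      using lo by blast
    then have "rank P y < rank P x"
      unfolding rank_def by (intro psubset_card_mono) auto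
    with le show False by simp
  qed
qed

lemma inj_rank:
  fixes P :: "'a::finite preference"
  assumes "linear_order P"
  shows "inj (rank P)"
  by (rule injI) (metis assms linear_orderD(3) order_refl rank_le_iff)

lemma ranked_rank:
  fixes P :: "'a::finite preference"
  assumes "linear_order P"
  shows "ranked (rank P x) P = x"
  unfolding ranked_def rank_def[symmetric]
  by (rule the_equality) (auto dest: injD[OF inj_rank[OF assms]])

lemma rank_bounds:
  fixes P :: "'a::finite preference"
  assumes "linear_order P"
  shows "1 \<le> rank P x" and "rank P x \<le> CARD('a)"
proof -
  have "{x} \<subseteq> {y. (y, x) \<in> P}"
    using linear_orderD(1)[OF assms] by blast
  then have "card {x} \<le> card {y. (y, x) \<in> P}"
    by (rule card_mono[rotated]) simp
  then show "1 \<le> rank P x"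
    by (simp add: rank_def)
  show "rank P x \<le> CARD('a)"
    unfolding rank_def by (rule card_mono) auto
qed

text \<open>An injection into a finite set of the same size is onto, so each \<open>k\<close> in
  this range is the rank of some alternative.\<close>

lemma rank_ranked:
  fixes P :: "'a::finite preference"
  assumes "linear_order P" "1 \<le> k" "k \<le> CARD('a)"
  shows "rank P (ranked k P) = k"
proof -
  have "range (rank P) = {1..CARD('a)}"
  proof (rule card_subset_eq)
    show "range (rank P) \<subseteq> {1..CARD('a)}"
      using rank_bounds[OF assms(1)] by auto
    show "card (range (rank P)) = card {1..CARD('a)}"
      using card_image[OF inj_rank[OF assms(1)]] by simp
  qed simp
  then obtain x where "rank P x = k"
    using assms(2,3) by (metis atLeastAtMost_iff imageE)
  then show ?thesis
    using ranked_rank[OF assms(1)] by metis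
qed

lemma peak_best:
  fixes P :: "'a::finite preference"
  assumes "linear_order P"
  shows "(peak P, z) \<in> P"
proof -
  have "1 \<le> CARD('a)"
    by (simp add: Suc_le_eq)
  then have "rank P (peak P) = 1"
    using rank_ranked[OF assms, of 1] by simp
  then show ?thesis
    using rank_le_iff[OF assms] rank_bounds(1)[OF assms] by metis
qed

lemma second_best:
  fixes P :: "'a::finite preference"
  assumes lin: "linear_order P" and z: "z \<noteq> peak P" and card: "2 \<le> CARD('a)"
  shows "(ranked 2 P, z) \<in> P"
proof -
  have "rank P (ranked 2 P) = 2"
    using rank_ranked[OF lin, of 2] card by simp
  moreover have "rank P z \<noteq> 1"
    using z ranked_rank[OF lin, of z] by metis
  then have "2 \<le> rank P z"
    using rank_bounds(1)[OF lin, of z] by linarith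
  ultimately show ?thesis
    using rank_le_iff[OF lin] by metis
qed

lemma best_eqI:
  assumes "linear_order P" "x \<in> B" "\<And>y. y \<in> B \<Longrightarrow> (x, y) \<in> P"
  shows "best P B = x"
  unfolding best_def using assms linear_orderD(3)[OF assms(1)]
  by (intro the_equality) blast+

lemma best_le:
  fixes P :: "'a::finite preference"
  assumes lin: "linear_order P" and y: "y \<in> B"
  shows "(best P B, y) \<in> P"
proof -
  obtain x where x: "x \<in> B" and min: "\<And>z. z \<in> B \<Longrightarrow> rank P x \<le> rank P z"
    using ex_has_least_nat[of "\<lambda>x. x \<in> B" y "rank P"] y by blast
  then have "\<And>z. z \<in> B \<Longrightarrow> (x, z) \<in> P"
    using rank_le_iff[OF lin] by blast
  then show ?thesis
    using best_eqI[OF lin x] y by blast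
qed

text \<open>Two adjacent preferences differ only by a swap of their top two alternatives, so every
  comparison whose better member is outside that pair carries over.\<close>

lemma adjacency_graph_transfer:
  fixes D :: "'a::finite preference set"
  assumes adj: "(v, w) \<in> adjacency_graph D" and lin: "\<And>P. P \<in> D \<Longrightarrow> linear_order P"
  obtains P P' where "P \<in> D" "P' \<in> D" "peak P = v" "peak P' = w" "ranked 2 P' = v"
    "\<And>x y. x \<notin> {v, w} \<Longrightarrow> (x, y) \<in> P \<Longrightarrow> (x, y) \<in> P'"
proof -
  from adj obtain P P' where P: "P \<in> D" "P' \<in> D" and vw: "v \<noteq> w"
    and r: "ranked 1 P = v" "ranked 2 P' = v" "ranked 1 P' = w" "ranked 2 P = w"
    and k: "\<forall>k\<in>{3..CARD('a)}. ranked k P = ranked k P'"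
    unfolding adjacency_graph_def by auto
  note lP = lin[OF P(1)] and lP' = lin[OF P(2)]
  have "card {v, w} \<le> CARD('a)"
    by (rule card_mono) auto
  then have two: "2 \<le> CARD('a)"
    using vw by simp
  have same: "rank P' x = rank P x" if x: "x \<notin> {v, w}" for x
  proof -
    have "rank P x \<noteq> 1" "rank P x \<noteq> 2"
      using ranked_rank[OF lP, of x] r x by auto
    then have "3 \<le> rank P x"
      using rank_bounds(1)[OF lP, of x] by linarith
    then have "ranked (rank P x) P' = x"
      using k rank_bounds(2)[OF lP, of x] ranked_rank[OF lP, of x] by auto
    then show ?thesis
      using rank_ranked[OF lP' rank_bounds[OF lP, of x]] by simp
  qed
  \<comment> \<open>Since \<open>v\<close> and \<open>w\<close> fill the top two places, an
    alternative below \<open>x\<close> is neither of them, so both ranks are unchanged.\<close>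
  have "(x, y) \<in> P'" if x: "x \<notin> {v, w}" and xy: "(x, y) \<in> P" for x y
  proof -
    have "(v, x) \<in> P" "(w, x) \<in> P"
      using peak_best[OF lP] second_best[OF lP _ two] r x by auto
    then have "y \<notin> {v, w}"
      using x xy linear_orderD(3)[OF lP] by auto
    then show ?thesis
      using same x xy rank_le_iff[OF lP] rank_le_iff[OF lP'] by metis
  qed
  with P r that show thesis by blast
qed

section \<open>Paths in trees\<close>

lemma rtrancl_imp_path_between:
  assumes "(u, v) \<in> G\<^sup>*"
  shows "\<exists>p. path_between G u v p"
  using assms
proof (induction rule: converse_rtrancl_induct)
  case base
  have "path_between G v v [v]"
    by (simp add: path_between_def)
  then show ?case ..
next
  case (step u w)
  then obtain p where p: "path_between G w v p" by blast
  show ?case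
  proof (cases "u \<in> set p")
    case True
    then obtain xs ys where "p = xs @ u # ys"
      by (meson split_list)
    then have "path_between G u v (u # ys)"
      using p by (auto simp: path_between_def successively_append_iff)
    then show ?thesis ..
  next
    case False
    then have "path_between G u v (u # p)"
      using p step.hyps by (auto simp: path_between_def successively_Cons)
    then show ?thesis ..
  qed
qed

text \<open>The start must be assumed in \<open>W\<close>: a one-vertex path uses no edge, so the
  induced subgraph does not constrain it.\<close>

lemma path_between_induced_subset:
  assumes "path_between (induced_subgraph G W) u v p" "u \<in> W"
  shows "set p \<subseteq> W"
proof -
  have "set q \<subseteq> W" if "successively (\<lambda>u v. (u, v) \<in> induced_subgraph G W) q" "q \<noteq> []" "hd q \<in> W"
    for q
    using that
  proof (induction q)
    case (Cons a q)
    then show ?case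
      by (cases "q = []") (auto simp: successively_Cons induced_subgraph_def)
  qed simp
  then show ?thesis
    using assms by (auto simp: path_between_def)
qed

lemma path_between_mono:
  assumes "path_between G u v p" "G \<subseteq> H"
  shows "path_between H u v p"
  using assms by (auto simp: path_between_def intro: successively_mono)

lemma path_between_imp_rtrancl:
  assumes "path_between G u v p" "set p \<subseteq> W"
  shows "(u, v) \<in> (induced_subgraph G W)\<^sup>*"
proof -
  have "(hd q, last q) \<in> (induced_subgraph G W)\<^sup>*"
    if "successively (\<lambda>u v. (u, v) \<in> G) q" "q \<noteq> []" "set q \<subseteq> W" for q
    using that
  proof (induction q)
    case (Cons a q)
    show ?case
    proof (cases "q = []")
      case False
      then have "(a, hd q) \<in> induced_subgraph G W"
        using Cons.prems hd_in_set[OF False] by (auto simp: induced_subgraph_def successively_Cons)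
      moreover have "(hd q, last q) \<in> (induced_subgraph G W)\<^sup>*"
        using Cons False by (auto simp: successively_Cons)
      ultimately show ?thesis
        using False by (simp add: converse_rtrancl_into_rtrancl)
    qed simp
  qed simp
  then show ?thesis
    using assms by (auto simp: path_between_def)
qed

lemma path_between_rev:
  assumes "sym G" "path_between G u v p"
  shows "path_between G v u (rev p)"
proof -
  have "successively (\<lambda>u v. (v, u) \<in> G) p"
    using assms by (auto simp: path_between_def elim!: successively_mono dest: symD)
  then show ?thesis
    using assms(2) by (auto simp: path_between_def hd_rev last_rev)
qed

text \<open>If two paths leave \<open>x\<close> through different neighbours, their remainders
  connect these neighbours without meeting \<open>x\<close>; a path joining the neighbours off
  \<open>x\<close> closes up through \<open>x\<close> to a cycle.\<close>

lemma acyclic_path_between_unique: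
  assumes sym: "sym G" and acyclic: "\<nexists>p. cycle G p"
    and p: "path_between G x y p" and q: "path_between G x y q"
  shows "p = q"
  using p q
proof (induction p arbitrary: x q)
  case Nil
  then show ?case by (simp add: path_between_def)
next
  case (Cons x' p)
  then have x': "x' = x" by (simp add: path_between_def)
  from Cons.prems obtain q' where q: "q = x # q'"
    by (cases q) (auto simp: path_between_def)
  show ?case
  proof (cases "p = [] \<or> q' = []")
    case True
    moreover have "last (x # p) = last (x # q')" "x \<notin> set p" "x \<notin> set q'"
      using Cons.prems x' q by (auto simp: path_between_def)
    ultimately have "p = []" "q' = []"
      using last_in_set[of p] last_in_set[of q'] by (auto split: if_splits)
    then show ?thesis
      using x' q by simp
  next
    case False
    then have p': "path_between G (hd p) y p" and q': "path_between G (hd q') y q'"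
      and xp: "(x, hd p) \<in> G" "(x, hd q') \<in> G" and x: "x \<notin> set p" "x \<notin> set q'"
      using Cons.prems x' q by (auto simp: path_between_def successively_Cons)
    show ?thesis
    proof (cases "hd p = hd q'")
      case True
      then show ?thesis
        using Cons.IH[OF p'] q' q x' by simp
    next
      case neq: False
      let ?H = "induced_subgraph G (- {x})"
      have "(hd p, y) \<in> ?H\<^sup>*"
        by (rule path_between_imp_rtrancl[OF p']) (use x in simp)
      moreover have "(y, hd q') \<in> ?H\<^sup>*"
        by (rule path_between_imp_rtrancl[OF path_between_rev[OF sym q']]) (use x in simp)
      ultimately have "(hd p, hd q') \<in> ?H\<^sup>*"
        by simp
      then obtain r where r: "path_between ?H (hd p) (hd q') r"
        using rtrancl_imp_path_between by metis
      have "hd p \<in> - {x}"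
        using x False by (metis ComplI hd_in_set singletonD)
      then have xr: "x \<notin> set r"
        using path_between_induced_subset[OF r] by blast
      have r': "path_between G (hd p) (hd q') r"
        using path_between_mono[OF r] by (auto simp: induced_subgraph_def)
      have "cycle G (x # r)"
        unfolding cycle_def
      proof (intro conjI)
        show "3 \<le> length (x # r)"
          using r' neq unfolding path_between_def
          by (cases r rule: remdups_adj.cases) auto
      qed (use r' xr xp sym in \<open>auto simp: path_between_def successively_Cons dest: symD\<close>)
      then show ?thesis
        using acyclic by blast
    qed
  qed
qed

section \<open>Betweenness along the paths of a finite tree\<close>

locale finite_tree =
  fixes T :: "'a::finite graph"
  assumes tree: "tree T"
begin

abbreviation tpath ("\<langle>_, _\<rangle>") where "\<langle>x, y\<rangle> \<equiv> tree_path T x y"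

lemma sym_T: "sym T" and irrefl_T: "irrefl T"
  using tree by (auto simp: tree_def simple_graph_def)

lemma tree_path_eq:
  assumes "path_between T x y p"
  shows "\<langle>x, y\<rangle> = set p"
proof -
  have "(THE p. path_between T x y p) = p"
    using assms acyclic_path_between_unique[OF sym_T] tree
    by (intro the_equality) (auto simp: tree_def)
  then show ?thesis
    by (simp add: tree_path_def)
qed

lemma obtain_path:
  obtains p where "path_between T x y p" "\<langle>x, y\<rangle> = set p"
  using tree rtrancl_imp_path_between[of x y T] tree_path_eq
  unfolding tree_def connected_graph_def by metis

lemma endpoints_in_tree_path [simp]: "x \<in> \<langle>x, y\<rangle>" "y \<in> \<langle>x, y\<rangle>"
proof -
  obtain p where "path_between T x y p" "\<langle>x, y\<rangle> = set p"
    by (rule obtain_path)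
  then show "x \<in> \<langle>x, y\<rangle>" "y \<in> \<langle>x, y\<rangle>"
    unfolding path_between_def by (metis hd_in_set, metis last_in_set)
qed

lemma tree_path_sym: "\<langle>x, y\<rangle> = \<langle>y, x\<rangle>"
proof -
  obtain p where "path_between T x y p" "\<langle>x, y\<rangle> = set p"
    by (rule obtain_path)
  then show ?thesis
    using tree_path_eq[OF path_between_rev[OF sym_T]] by simp
qed

text \<open>Walking from \<open>x\<close> to \<open>y\<close> and on to \<open>z\<close> stays in
  the union, so some path from \<open>x\<close> to \<open>z\<close> lies in it, and this path is the
  unique one.\<close>

lemma tree_path_triangle: "\<langle>x, z\<rangle> \<subseteq> \<langle>x, y\<rangle> \<union> \<langle>y, z\<rangle>"
proof -
  obtain p where p: "path_between T x y p" "\<langle>x, y\<rangle> = set p" by (rule obtain_path)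
  obtain q where q: "path_between T y z q" "\<langle>y, z\<rangle> = set q" by (rule obtain_path)
  let ?W = "\<langle>x, y\<rangle> \<union> \<langle>y, z\<rangle>"
  have "(x, z) \<in> (induced_subgraph T ?W)\<^sup>*"
    using path_between_imp_rtrancl[OF p(1), of ?W] path_between_imp_rtrancl[OF q(1), of ?W] p q
    by (metis Un_upper1 Un_upper2 rtrancl_trans)
  then obtain r where r: "path_between (induced_subgraph T ?W) x z r"
    using rtrancl_imp_path_between by metis
  then have "\<langle>x, z\<rangle> = set r"
    using tree_path_eq path_between_mono by (metis induced_subgraph_def inf_le1)
  then show ?thesis
    using path_between_induced_subset[OF r] by simp
qed

lemma tree_path_antisym:
  assumes "v \<in> \<langle>u, z\<rangle>" "u \<in> \<langle>v, z\<rangle>"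
  shows "u = v"
proof -
  obtain p where p: "path_between T u z p" "\<langle>u, z\<rangle> = set p" by (rule obtain_path)
  with assms(1) obtain xs ys where xs: "p = xs @ v # ys"
    by (metis split_list)
  then have "path_between T v z (v # ys)"
    using p(1) by (auto simp: path_between_def successively_append_iff)
  then have "u \<in> set (v # ys)"
    using assms(2) tree_path_eq by blast
  then show ?thesis
    using p(1) xs by (cases xs) (auto simp: path_between_def)
qed

lemma tree_path_refl [simp]: "\<langle>x, x\<rangle> = {x}"
  using tree_path_antisym[of _ x x] by auto

lemma tree_path_edge:
  assumes "(x, y) \<in> T"
  shows "\<langle>x, y\<rangle> = {x, y}"
proof -
  have "path_between T x y [x, y]"
    using assms irrefl_T by (auto simp: path_between_def irrefl_def)
  then show ?thesis
    using tree_path_eq by fastforce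
qed

lemma tree_path_concat:
  assumes "\<langle>a, m\<rangle> \<inter> \<langle>m, w\<rangle> \<subseteq> {m}"
  shows "m \<in> \<langle>a, w\<rangle>"
proof -
  obtain p where p: "path_between T a m p" "\<langle>a, m\<rangle> = set p" by (rule obtain_path)
  obtain q where q: "path_between T m w q" "\<langle>m, w\<rangle> = set q" by (rule obtain_path)
  from q(1) obtain q' where q': "q = m # q'"
    by (cases q) (auto simp: path_between_def)
  have "path_between T a w (p @ q')"
    using p(1) q(1) assms unfolding p(2) q(2) q'
    by (auto simp: path_between_def successively_append_iff successively_Cons)
  then show ?thesis
    using tree_path_eq p by force
qed

text \<open>By the triangle inclusion \<open>u\<close> lies on \<open>\<langle>p, v\<rangle>\<close>
  or on \<open>\<langle>v, z\<rangle>\<close>; in the latter case antisymmetry gives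
  \<open>u = v\<close>.\<close>

lemma tree_path_between:
  assumes "u \<in> \<langle>p, z\<rangle>" "v \<in> \<langle>u, z\<rangle>"
  shows "u \<in> \<langle>p, v\<rangle>"
  using assms tree_path_triangle[of p z v] tree_path_antisym[of v u z] by auto

lemma tree_path_trans:
  assumes "u \<in> \<langle>p, z\<rangle>" "v \<in> \<langle>u, z\<rangle>"
  shows "v \<in> \<langle>p, z\<rangle>"
  using assms tree_path_triangle[of u z p] tree_path_triangle[of p z v]
    tree_path_antisym[of v u] tree_path_sym
  by blast

lemma tree_path_trans':
  assumes "u \<in> \<langle>p, z\<rangle>" "v \<in> \<langle>p, u\<rangle>"
  shows "v \<in> \<langle>p, z\<rangle>"
  using assms tree_path_trans tree_path_sym by metis

text \<open>Two paths that traverse a common segment from \<open>y\<close> to \<open>x\<close> in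
  the same direction combine into one. The segment must be nondegenerate: paths sharing only a
  vertex may backtrack there.\<close>

lemma tree_path_glue:
  assumes "y \<in> \<langle>p, x\<rangle>" "x \<in> \<langle>y, c\<rangle>" "x \<noteq> y"
  shows "x \<in> \<langle>p, c\<rangle>" and "y \<in> \<langle>p, c\<rangle>"
proof -
  show x: "x \<in> \<langle>p, c\<rangle>"
    using assms tree_path_triangle[of y c p] tree_path_antisym[of x y p] tree_path_sym by blast
  show "y \<in> \<langle>p, c\<rangle>"
    using assms x tree_path_trans' by blast
qed

lemma tree_path_convex:
  assumes "m \<in> \<langle>p, c\<rangle>" "w \<in> \<langle>p, c\<rangle>"
  shows "\<langle>m, w\<rangle> \<subseteq> \<langle>p, c\<rangle>"
proof -
  have *: "\<langle>m, w\<rangle> \<subseteq> \<langle>p, c\<rangle>" if "m \<in> \<langle>p, w\<rangle>" "w \<in> \<langle>p, c\<rangle>" for m w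
    using that tree_path_trans tree_path_trans' by blast
  have "m \<in> \<langle>p, w\<rangle> \<or> w \<in> \<langle>p, m\<rangle>"
    using assms tree_path_triangle[of p c w] tree_path_between by blast
  then show ?thesis
    using * assms tree_path_sym by metis
qed

section \<open>Projections onto paths and the two sides of an edge\<close>

lemma projection_exists:
  obtains m where "m \<in> \<langle>p, c\<rangle>" "\<And>w. w \<in> \<langle>p, c\<rangle> \<Longrightarrow> m \<in> \<langle>a, w\<rangle>"
proof -
  let ?f = "\<lambda>m. card \<langle>a, m\<rangle>"
  obtain m where m: "m \<in> \<langle>p, c\<rangle>" and min: "\<And>n. n \<in> \<langle>p, c\<rangle> \<Longrightarrow> ?f m \<le> ?f n"
    using ex_has_least_nat[of "\<lambda>x. x \<in> \<langle>p, c\<rangle>" p ?f] by auto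
  \<comment> \<open>Minimality of \<open>m\<close> means that the path from \<open>a\<close> to
    \<open>m\<close> meets \<open>\<langle>p, c\<rangle>\<close> in \<open>m\<close> only, so it can
    be prolonged along \<open>\<langle>p, c\<rangle>\<close> to any \<open>w\<close>.\<close>
  have nearest: "n = m" if n: "n \<in> \<langle>p, c\<rangle>" "n \<in> \<langle>a, m\<rangle>" for n
  proof (rule ccontr)
    assume "n \<noteq> m"
    then have "m \<notin> \<langle>a, n\<rangle>"
      using n(2) tree_path_antisym tree_path_sym by metis
    then have "\<langle>a, n\<rangle> \<subset> \<langle>a, m\<rangle>"
      using n(2) tree_path_trans' endpoints_in_tree_path(2) by blast
    then have "?f n < ?f m"
      by (intro psubset_card_mono) auto
    with min[OF n(1)] show False by simp
  qed
  have "m \<in> \<langle>a, w\<rangle>" if "w \<in> \<langle>p, c\<rangle>" for w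
    by (rule tree_path_concat) (use tree_path_convex[OF m that] nearest in blast)
  with m that show thesis by blast
qed

lemma proj_eqI:
  assumes "a \<notin> S" "m \<in> S" "\<And>w. w \<in> S \<Longrightarrow> m \<in> \<langle>a, w\<rangle>"
  shows "proj T a S = m"
proof -
  have "(THE a'. a' \<in> S \<and> (\<forall>b\<in>S. a' \<in> \<langle>a, b\<rangle>)) = m"
  proof (rule the_equality)
    fix m' assume m': "m' \<in> S \<and> (\<forall>b\<in>S. m' \<in> \<langle>a, b\<rangle>)"
    then have "m' \<in> \<langle>m, a\<rangle>" "m \<in> \<langle>m', a\<rangle>"
      using assms(2,3) tree_path_sym by blast+
    then show "m' = m"
      using tree_path_antisym by blast
  qed (use assms in blast)
  with assms(1) show ?thesis
    by (simp add: proj_def)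
qed

lemma proj_beyond:
  assumes "c \<in> \<langle>p, z\<rangle>" "z \<noteq> c"
  shows "z \<notin> \<langle>p, c\<rangle>" and "proj T z \<langle>p, c\<rangle> = c"
proof -
  show z: "z \<notin> \<langle>p, c\<rangle>"
    using assms tree_path_antisym tree_path_sym by metis
  show "proj T z \<langle>p, c\<rangle> = c"
  proof (rule proj_eqI[OF z])
    fix w assume "w \<in> \<langle>p, c\<rangle>"
    then show "c \<in> \<langle>z, w\<rangle>"
      using assms(1) tree_path_between tree_path_sym by metis
  qed simp
qed

text \<open>If \<open>y\<close> is not on the path from \<open>z\<close> to \<open>x\<close>,
  appending the edge to that path gives the path from \<open>z\<close> to \<open>y\<close>.\<close>

lemma sides_cover:
  assumes "(x, y) \<in> T"
  shows "z \<in> side T x y \<or> z \<in> side T y x"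
proof -
  have "x \<in> \<langle>z, y\<rangle>" if "y \<notin> \<langle>z, x\<rangle>"
    by (rule tree_path_concat) (use that tree_path_edge[OF assms] in auto)
  then show ?thesis
    by (auto simp: side_def)
qed

section \<open>Semi-single-peaked preferences\<close>

lemma semi_single_peaked_path:
  assumes "semi_single_peaked T c P" "v \<in> \<langle>peak P, c\<rangle>" "u \<in> \<langle>peak P, v\<rangle>" "u \<noteq> v"
  shows "(u, v) \<in> P"
  using assms tree_path_trans' by (auto simp: semi_single_peaked_def)

lemma semi_single_peaked_beyond:
  assumes "semi_single_peaked T c P" "c \<in> \<langle>peak P, z\<rangle>" "z \<noteq> c"
  shows "(c, z) \<in> P"
  using assms proj_beyond[OF assms(2,3)] by (metis semi_single_peaked_def)

text \<open>Let \<open>m\<close> be the projection of \<open>a\<close> on the long path. If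
  \<open>m\<close> is on the short path, it is still the projection. Otherwise the projection
  becomes \<open>y\<close>, which precedes \<open>m\<close> on the way to \<open>c\<close> and so is
  ranked above \<open>m\<close>, which is ranked above \<open>a\<close>. This gives condition (i) of
  critical spots.\<close>

lemma semi_single_peaked_nearer:
  assumes lin: "linear_order P" and ssp: "semi_single_peaked T c P" and y: "y \<in> \<langle>peak P, c\<rangle>"
  shows "semi_single_peaked T y P"
  unfolding semi_single_peaked_def
proof (intro conjI ballI allI impI)
  fix u v assume "v \<in> \<langle>peak P, y\<rangle>" "u \<noteq> v" "u \<in> \<langle>peak P, v\<rangle>"
  then show "(u, v) \<in> P"
    using semi_single_peaked_path[OF ssp] tree_path_trans'[OF y] by blast
next
  let ?p = "peak P"
  fix a assume a: "a \<notin> \<langle>?p, y\<rangle>"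
  show "(proj T a \<langle>?p, y\<rangle>, a) \<in> P"
  proof (cases "a \<in> \<langle>?p, c\<rangle>")
    case True
    then have "a \<in> \<langle>y, c\<rangle>"
      using a tree_path_triangle[of ?p c y] by blast
    then have "y \<in> \<langle>?p, a\<rangle>"
      using y tree_path_between by blast
    moreover have "a \<noteq> y"
      using a by auto
    ultimately show ?thesis
      using proj_beyond(2) semi_single_peaked_path[OF ssp True] by metis
  next
    case False
    obtain m where m: "m \<in> \<langle>?p, c\<rangle>" "\<And>w. w \<in> \<langle>?p, c\<rangle> \<Longrightarrow> m \<in> \<langle>a, w\<rangle>"
      using projection_exists by metis
    then have ma: "(m, a) \<in> P"
      using ssp False proj_eqI[OF False m] by (metis semi_single_peaked_def)
    show ?thesis
    proof (cases "m \<in> \<langle>?p, y\<rangle>")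
      case True
      then have "proj T a \<langle>?p, y\<rangle> = m"
        using a m y tree_path_trans' by (intro proj_eqI) blast+
      with ma show ?thesis by simp
    next
      case False
      then have "m \<in> \<langle>y, c\<rangle>"
        using m(1) tree_path_triangle[of ?p c y] by blast
      then have ym: "y \<in> \<langle>?p, m\<rangle>"
        using y tree_path_between by blast
      moreover have "m \<in> \<langle>a, ?p\<rangle>"
        using m(2) by simp
      ultimately have "y \<in> \<langle>?p, a\<rangle>"
        using tree_path_sym tree_path_trans by metis
      moreover have "a \<noteq> y"
        using a by auto
      ultimately have "proj T a \<langle>?p, y\<rangle> = y"
        using proj_beyond(2) by blast
      moreover have "(y, m) \<in> P"
        using semi_single_peaked_path[OF ssp m(1) ym] False by fastforce
      ultimately show ?thesis
        using ma linear_orderD(2)[OF lin] by metis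
    qed
  qed
qed

section \<open>Badly ordered edges and critical spots\<close>

text \<open>If every vertex on the way from \<open>u\<close> to \<open>z\<close> were at least as
  good as its successor, transitivity would give \<open>(u, z) \<in> P\<close>; so some consecutive
  pair \<open>y\<close>, \<open>x\<close> is ranked the wrong way.\<close>

lemma badly_ordered_edge:
  assumes lin: "linear_order P" and u: "u \<in> \<langle>q, z\<rangle>" and bad: "(u, z) \<notin> P"
  obtains x y where "(x, y) \<in> T" "x \<in> \<langle>u, z\<rangle>" "y \<in> \<langle>u, z\<rangle>" "y \<in> \<langle>q, x\<rangle>" "(y, x) \<notin> P"
proof -
  obtain p where p: "path_between T q z p" "\<langle>q, z\<rangle> = set p" by (rule obtain_path)
  with u obtain ys zs where split: "p = ys @ u # zs"
    by (metis split_list)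
  have "path_between T u z (u # zs)"
    using p(1) split by (auto simp: path_between_def successively_append_iff)
  then have uz: "\<langle>u, z\<rangle> = set (u # zs)"
    by (rule tree_path_eq)
  have "\<exists>l1 y x l2. v # l = l1 @ y # x # l2 \<and> (y, x) \<notin> P" if "(v, last (v # l)) \<notin> P" for v l
    using that
  proof (induction l arbitrary: v)
    case Nil
    then show ?case using linear_orderD(1)[OF lin] by simp
  next
    case (Cons w l)
    show ?case
    proof (cases "(v, w) \<in> P")
      case True
      then have "(w, last (w # l)) \<notin> P"
        using Cons.prems linear_orderD(2)[OF lin] by auto
      then show ?thesis
        using Cons.IH by (metis append_Cons)
    next
      case False
      then show ?thesis by (metis append_Nil)
    qed
  qed
  moreover have "last (u # zs) = z"
    using p(1) split by (simp add: path_between_def)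
  ultimately obtain l1 y x l2 where l: "u # zs = l1 @ y # x # l2" "(y, x) \<notin> P"
    using bad by metis
  have p': "p = (ys @ l1) @ y # x # l2"
    using split l(1) by simp
  have "path_between T q x ((ys @ l1) @ [y, x])"
    using p(1) unfolding p' path_between_def by (auto simp: successively_append_iff hd_append)
  then have "y \<in> \<langle>q, x\<rangle>"
    using tree_path_eq by fastforce
  moreover have "(x, y) \<in> T"
    using p(1) symD[OF sym_T] unfolding p' path_between_def by (auto simp: successively_append_iff)
  ultimately show thesis
    using that l uz by auto
qed

text \<open>\<open>gate\<close> makes \<open>c\<close> the only passage between \<open>B\<close> and
  its complement. \<open>outside\<close> also covers the peak \<open>c\<close> itself. With
  \<open>c\<close> best in \<open>B\<close> for such peaks, misordered edges inside \<open>B\<close>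
  stay clear of \<open>c\<close>.\<close>

lemma critical_spot_in_branch:
  assumes card: "2 \<le> CARD('a)"
    and lin: "\<And>P. P \<in> D \<Longrightarrow> linear_order P"
    and conn: "connected_graph (adjacency_graph D)"
    and c: "c \<in> B"
    and gate: "\<And>u v. u \<in> B \<Longrightarrow> v \<notin> B \<Longrightarrow> c \<in> \<langle>u, v\<rangle>"
    and ssp: "\<And>P. P \<in> D \<Longrightarrow> peak P \<in> B - {c} \<Longrightarrow> semi_single_peaked T c P"
    and outside: "\<And>P. P \<in> D \<Longrightarrow> peak P \<notin> B - {c} \<Longrightarrow> best P B = c"
    and bad: "P \<in> D" "u \<in> B" "z \<in> B" "u \<in> \<langle>peak P, z\<rangle>" "(u, z) \<notin> P"
  shows "\<exists>x y. critical_spot D T x y \<and> x \<in> B - {c} \<and> y \<in> B - {c}"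
proof -
  \<comment> \<open>A path between members of \<open>B\<close> that left \<open>B\<close> would have
    to pass \<open>c\<close> both on the way out and on the way back.\<close>
  have convex: "w \<in> B" if uv: "u \<in> B" "v \<in> B" and w: "w \<in> \<langle>u, v\<rangle>" for u v w
  proof (rule ccontr)
    assume nB: "w \<notin> B"
    then have "c \<in> \<langle>u, w\<rangle>" "c \<in> \<langle>v, w\<rangle>"
      using uv gate by auto
    then have "w \<in> \<langle>c, v\<rangle>" "c \<in> \<langle>w, v\<rangle>"
      using w tree_path_between tree_path_sym by metis+
    then have "w = c"
      using tree_path_antisym by blast
    with nB c show False by simp
  qed

  \<comment> \<open>The orientation of an edge in \<open>V\<close> comes from the peak of the
    witnessing preference; that \<open>y\<close> is also the end nearer to \<open>c\<close> is a
    consequence, established in \<open>toward\<close>.\<close>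
  define V where "V = {(x, y). (x, y) \<in> T \<and> x \<in> B \<and> y \<in> B \<and>
    (\<exists>P\<in>D. peak P \<in> side T y x \<and> (y, x) \<notin> P)}"
  have edge: "\<exists>x y. (x, y) \<in> V \<and> x \<in> \<langle>u, z\<rangle> \<and> y \<in> \<langle>u, z\<rangle> \<and> y \<in> \<langle>peak P, x\<rangle>"
    if uz: "P \<in> D" "u \<in> B" "z \<in> B" "u \<in> \<langle>peak P, z\<rangle>" "(u, z) \<notin> P" for P u z
  proof -
    obtain x y where xy: "(x, y) \<in> T" "x \<in> \<langle>u, z\<rangle>" "y \<in> \<langle>u, z\<rangle>" "y \<in> \<langle>peak P, x\<rangle>" "(y, x) \<notin> P"
      by (rule badly_ordered_edge[OF lin[OF uz(1)] uz(4,5)])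
    then have "(x, y) \<in> V"
      using uz(1) convex[OF uz(2,3) xy(2)] convex[OF uz(2,3) xy(3)]
      unfolding V_def side_def by blast
    with xy show ?thesis by blast
  qed

  have ne: "x \<noteq> y" if "(x, y) \<in> V" for x y
    using that irrefl_T by (auto simp: V_def irrefl_def)

  \<comment> \<open>If \<open>x\<close> were nearer to \<open>c\<close>, the peak would lie in
    \<open>B - {c}\<close>, and the way from it to \<open>c\<close> would visit \<open>y\<close> and
    then \<open>x\<close>; semi-single-peakedness would rank \<open>y\<close> above
    \<open>x\<close>.\<close>
  have toward: "y \<in> \<langle>c, x\<rangle>" "x \<noteq> c" "y \<noteq> c" if V: "(x, y) \<in> V" for x y
  proof -
    from V obtain P where xy: "(x, y) \<in> T" "x \<in> B" "y \<in> B"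
      and P: "P \<in> D" and yp: "y \<in> \<langle>peak P, x\<rangle>" and nP: "(y, x) \<notin> P"
      by (auto simp: V_def side_def)
    show y: "y \<in> \<langle>c, x\<rangle>"
    proof (rule ccontr)
      assume "y \<notin> \<langle>c, x\<rangle>"
      then have x: "x \<in> \<langle>c, y\<rangle>"
        using sides_cover[OF xy(1), of c] by (auto simp: side_def)
      have "peak P \<in> B"
      proof (rule ccontr)
        assume "peak P \<notin> B"
        then have "c \<in> \<langle>y, peak P\<rangle>"
          using gate xy(3) by blast
        then have "x \<in> \<langle>y, peak P\<rangle>"
          using x tree_path_trans' tree_path_sym by metis
        then show False
          using yp ne[OF V] tree_path_antisym tree_path_sym by metis
      qed
      moreover have "peak P \<noteq> c"
        using yp \<open>y \<notin> \<langle>c, x\<rangle>\<close> by auto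
      ultimately have S: "semi_single_peaked T c P"
        using ssp[OF P] by blast
      have "x \<in> \<langle>peak P, c\<rangle>"
        using tree_path_glue(1)[OF yp _ ne[OF V]] x tree_path_sym by blast
      then have "(y, x) \<in> P"
        using semi_single_peaked_path[OF S _ yp] ne[OF V] by blast
      with nP show False ..
    qed
    show "x \<noteq> c"
      using y ne[OF V] by auto
    show "y \<noteq> c"
    proof
      assume yc: "y = c"
      \<comment> \<open>For a peak in \<open>B - {c}\<close>, the vertex \<open>x\<close> lies
        beyond \<open>c\<close> and is therefore worse; for any other peak \<open>c\<close> is best
        in \<open>B\<close>.\<close>
      have "(c, x) \<in> P"
      proof (cases "peak P \<in> B - {c}")
        case True
        then show ?thesis
          using semi_single_peaked_beyond[OF ssp[OF P True], of x] yp yc ne[OF V] by blast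
      next
        case False
        then show ?thesis
          using best_le[OF lin[OF P] xy(2)] outside[OF P False] by simp
      qed
      with nP yc show False by simp
    qed
  qed

  have "\<exists>e. e \<in> V"
    using edge[OF bad] by blast
  then obtain x y where V: "(x, y) \<in> V"
    and min: "\<And>x' y'. (x', y') \<in> V \<Longrightarrow> card (side T x y) \<le> card (side T x' y')"
    using ex_has_least_nat[of "\<lambda>e. e \<in> V" _ "\<lambda>(x, y). card (side T x y)"] by fastforce
  from V have xy: "(x, y) \<in> T" "x \<in> B" "y \<in> B"
    by (auto simp: V_def)
  note neq = ne[OF V] and tow = toward[OF V]

  \<comment> \<open>The whole side of \<open>x\<close> lies in \<open>B - {c}\<close>, and from
    there the way to \<open>c\<close> crosses the edge. Hence semi-single-peakedness with respect to
    \<open>c\<close> is available for every peak on that side.\<close>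
  have beyond: "y \<in> \<langle>w, c\<rangle>" "x \<in> \<langle>w, c\<rangle>" "w \<in> B - {c}" if "w \<in> side T x y" for w
  proof -
    have w: "x \<in> \<langle>w, y\<rangle>"
      using that by (simp add: side_def)
    then show "y \<in> \<langle>w, c\<rangle>" and xw: "x \<in> \<langle>w, c\<rangle>"
      using tree_path_glue[OF w, of c] tow(1) neq tree_path_sym by blast+
    have "w \<in> B"
    proof (rule ccontr)
      assume "w \<notin> B"
      then have "c \<in> \<langle>w, x\<rangle>"
        using gate xy(2) tree_path_sym by blast
      then show False
        using xw tow(2) tree_path_antisym tree_path_sym by metis
    qed
    moreover have "w \<noteq> c"
      using xw tow(2) by auto
    ultimately show "w \<in> B - {c}" by blast
  qed

  have "critical_spot D T x y"
    unfolding critical_spot_def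
  proof (intro conjI ballI impI)
    show "(x, y) \<in> T" by fact
    fix Q assume Q: "Q \<in> D"
    show "semi_single_peaked T y Q" if "peak Q \<in> side T x y"
      using semi_single_peaked_nearer lin[OF Q] ssp[OF Q] beyond[OF that] by blast
    assume q: "peak Q \<in> side T y x"
    show "best Q (side T x y) = x"
    proof (rule best_eqI[OF lin[OF Q]])
      show "x \<in> side T x y"
        by (simp add: side_def)
      fix z assume z: "z \<in> side T x y"
      show "(x, z) \<in> Q"
      proof (rule ccontr)
        assume nQ: "(x, z) \<notin> Q"
        have xz: "x \<in> \<langle>y, z\<rangle>" and yq: "y \<in> \<langle>peak Q, x\<rangle>"
          using z q tree_path_sym by (auto simp: side_def)
        then have "x \<in> \<langle>peak Q, z\<rangle>"
          using tree_path_glue(1) neq by blast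
        \<comment> \<open>A wrong comparison of \<open>x\<close> with \<open>z\<close> yields
          another edge of \<open>V\<close> between them; its outer side turns out to be properly
          contained in that of \<open>x\<close>, against minimality.\<close>
        then obtain x' y' where V': "(x', y') \<in> V" and xy': "y' \<in> \<langle>x, z\<rangle>" "y' \<in> \<langle>peak Q, x'\<rangle>"
          using edge[OF Q xy(2) _ _ nQ] beyond(3)[OF z] by blast
        have xyy: "x \<in> \<langle>y, y'\<rangle>"
          using tree_path_between[OF xz xy'(1)] .
        \<comment> \<open>This locates the new edge beyond \<open>x\<close> as seen from
          \<open>y\<close>, with \<open>y'\<close> nearer to \<open>y\<close> than
          \<open>x'\<close>.\<close>
        have "y' \<notin> \<langle>peak Q, y\<rangle>"
        proof
          assume "y' \<in> \<langle>peak Q, y\<rangle>"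
          then have "y \<in> \<langle>y', x\<rangle>"
            using yq tree_path_between tree_path_sym by metis
          then show False
            using xyy neq tree_path_antisym tree_path_sym by metis
        qed
        then have yx': "y' \<in> \<langle>y, x'\<rangle>"
          using xy'(2) tree_path_triangle by blast
        have "side T x' y' \<subseteq> side T x y"
        proof
          fix w assume "w \<in> side T x' y'"
          then have "x' \<in> \<langle>y', w\<rangle>"
            using tree_path_sym by (auto simp: side_def)
          then have "y' \<in> \<langle>y, w\<rangle>"
            using tree_path_glue(2)[OF yx' _ ne[OF V']] by blast
          then have "x \<in> \<langle>y, w\<rangle>"
            using xyy tree_path_trans' by blast
          then show "w \<in> side T x y"
            using tree_path_sym by (auto simp: side_def)
        qed
        moreover have "y' \<in> side T x y" "y' \<notin> side T x' y'"
          using xyy tree_path_sym ne[OF V'] by (auto simp: side_def)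
        ultimately have "card (side T x' y') < card (side T x y)"
          by (intro psubset_card_mono) auto
        with min[OF V'] show False by simp
      qed
    qed
  next
    show "\<exists>P\<in>D. \<exists>P'\<in>D. peak P = peak P' \<and> peak P \<in> side T y x \<and> (y, x) \<in> P \<and> (x, y) \<in> P'"
    proof (rule ccontr)
      assume no: "\<not> ?thesis"
      \<comment> \<open>If condition (iii) fails, preferences in \<open>D\<close> sharing a peak on
        the side of \<open>y\<close> agree on \<open>x\<close> and \<open>y\<close>. So one witness
        in \<open>S\<close> speaks for all preferences with that peak.\<close>
      define S where "S = {v \<in> side T y x. \<exists>P\<in>D. peak P = v \<and> (x, y) \<in> P}"
      have yS: "y \<notin> S"
      proof
        assume "y \<in> S"
        then obtain P where "P \<in> D" "peak P = y" "(x, y) \<in> P"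
          by (auto simp: S_def)
        then show False
          using peak_best[OF lin, of P x] linear_orderD(3)[OF lin] neq by blast
      qed
      have closed: "w \<in> S" if v: "v \<in> S" and vw: "(v, w) \<in> adjacency_graph D" for v w
      proof -
        obtain R R' where R: "R \<in> D" "R' \<in> D" "peak R = v" "peak R' = w" "ranked 2 R' = v"
          and transfer: "\<And>x y. x \<notin> {v, w} \<Longrightarrow> (x, y) \<in> R \<Longrightarrow> (x, y) \<in> R'"
          using adjacency_graph_transfer[OF vw lin] by metis
        note lR = lin[OF R(2)]
        have vy: "y \<in> \<langle>v, x\<rangle>" "v \<in> side T y x" "v \<noteq> y"
          using v yS by (auto simp: S_def side_def)
        have top: "u = v \<or> u = w" if "(u, v) \<in> R'" for u
          using that second_best[OF lR _ card, of u] R linear_orderD(3)[OF lR] by metis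
        \<comment> \<open>An adjacency step cannot cross the edge: \<open>v\<close> is second in
          \<open>R'\<close>, while \<open>y\<close> lies strictly between \<open>w\<close> and
          \<open>v\<close>. If \<open>v\<close> is on the way from \<open>w\<close> to
          \<open>c\<close>, then \<open>y\<close> would be a third alternative not below
          \<open>v\<close>. Otherwise the projection of \<open>v\<close> on that way is ranked above
          \<open>v\<close>, so it is \<open>w\<close>, contradicting that \<open>y\<close> comes
          between.\<close>
        have w: "w \<in> side T y x"
        proof (rule ccontr)
          assume "w \<notin> side T y x"
          then have wx: "w \<in> side T x y"
            using sides_cover[OF xy(1)] by blast
          have yw: "y \<noteq> w"
            using wx neq by (auto simp: side_def)
          have S: "semi_single_peaked T c R'"
            using ssp[OF R(2)] beyond(3)[OF wx] R(4) by simp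
          have ywv: "y \<in> \<langle>w, v\<rangle>"
            using tree_path_glue(2)[OF vy(1) _ neq, of w] wx tree_path_sym by (auto simp: side_def)
          show False
          proof (cases "v \<in> \<langle>w, c\<rangle>")
            case True
            then have "(y, v) \<in> R'"
              using semi_single_peaked_path[OF S, of v y] ywv R(4) vy(3) by auto
            then show False
              using top vy(3) yw by blast
          next
            case False
            obtain m where m: "m \<in> \<langle>w, c\<rangle>" "\<And>t. t \<in> \<langle>w, c\<rangle> \<Longrightarrow> m \<in> \<langle>v, t\<rangle>"
              using projection_exists by metis
            then have "(m, v) \<in> R'"
              using S False proj_eqI[OF False m] R(4) by (metis semi_single_peaked_def)
            then have "m = w"
              using top m(1) False by blast
            then have "w \<in> \<langle>v, y\<rangle>"
              using m(2) beyond(1)[OF wx] by blast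
            then show False
              using ywv yw tree_path_antisym tree_path_sym by metis
          qed
        qed
        \<comment> \<open>The witness for \<open>v\<close> in \<open>S\<close> need not be
          \<open>R\<close>, but the assumed failure of (iii) forces \<open>R\<close> to order
          \<open>x\<close> and \<open>y\<close> in the same way.\<close>
        have "(y, x) \<notin> R"
          using no R v R(3) vy(2) by (auto simp: S_def)
        then have "(x, y) \<in> R"
          using linear_orderD(4)[OF lin[OF R(1)]] by blast
        moreover have "x \<notin> {v, w}"
          using vy(2) w neq by (auto simp: side_def)
        ultimately have "(x, y) \<in> R'"
          using transfer by blast
        then show ?thesis
          using w R by (auto simp: S_def)
      qed
      from V obtain P where P: "P \<in> D" "peak P \<in> side T y x" "(y, x) \<notin> P"
        by (auto simp: V_def)
      then have start: "peak P \<in> S"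
        using linear_orderD(4)[OF lin] by (auto simp: S_def)
      \<comment> \<open>Connectedness carries membership in \<open>S\<close> along to
        \<open>y\<close>, although a preference with peak \<open>y\<close> cannot rank
        \<open>x\<close> above \<open>y\<close>.\<close>
      have "(peak P, y) \<in> (adjacency_graph D)\<^sup>*"
        using conn by (simp add: connected_graph_def)
      then have "y \<in> S"
        by (induction rule: rtrancl_induct) (use start closed in blast)+
      with yS show False ..
    qed
  qed
  then show ?thesis
    using xy tow by blast
qed

text \<open>Source of both converse directions: the second preference in condition (iii) ranks
  \<open>x\<close> above \<open>y\<close> although \<open>y\<close> lies between its peak and
  \<open>x\<close>.\<close>

lemma critical_spot_misordered:
  assumes "critical_spot D T x y" "\<And>P. P \<in> D \<Longrightarrow> linear_order P"
  obtains P where "P \<in> D" "y \<noteq> x" "y \<in> \<langle>peak P, x\<rangle>" "(y, x) \<notin> P"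
proof -
  have neq: "y \<noteq> x"
    using assms(1) irrefl_T by (auto simp: critical_spot_def irrefl_def)
  from assms(1) obtain P where "P \<in> D" "y \<in> \<langle>peak P, x\<rangle>" "(x, y) \<in> P"
    unfolding critical_spot_def side_def by fastforce
  then show thesis
    using that neq linear_orderD(3)[OF assms(2)] by blast
qed

text \<open>A vertex off the path projects to a threshold, which therefore separates it from the
  other threshold. So the three cases of \<open>semi_hybrid\<close> exhaust all peaks.\<close>

lemma dual_thresholds_cover:
  assumes "dual_thresholds T a b"
  shows "z \<in> side T a b \<or> z \<in> side T b a \<or> z \<in> \<langle>a, b\<rangle>"
proof (cases "z \<in> \<langle>a, b\<rangle>")
  case False
  obtain m where m: "m \<in> \<langle>a, b\<rangle>" "\<And>w. w \<in> \<langle>a, b\<rangle> \<Longrightarrow> m \<in> \<langle>z, w\<rangle>"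
    using projection_exists by metis
  then have "m = a \<or> m = b"
    using assms False proj_eqI[OF False m] by (auto simp: dual_thresholds_def)
  then show ?thesis
    using m(2) by (auto simp: side_def)
qed simp

text \<open>Gives condition (2) of hybrid preferences for all semi-hybrid ones, so that only
  condition (1) can fail.\<close>

lemma semi_single_peaked_best_path:
  assumes lin: "linear_order P" and ssp: "semi_single_peaked T a P" and p: "peak P \<in> side T a b"
  shows "best P \<langle>a, b\<rangle> = a"
proof (rule best_eqI[OF lin])
  fix z assume "z \<in> \<langle>a, b\<rangle>"
  then have "a \<in> \<langle>peak P, z\<rangle>"
    using p tree_path_between by (auto simp: side_def)
  then show "(a, z) \<in> P"
    using semi_single_peaked_beyond[OF ssp] linear_orderD(1)[OF lin] by metis
qed simp

text \<open>The branch is the side of \<open>a\<close>, attached at \<open>a\<close>. Stating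
  \<open>cover\<close> in place of \<open>dual_thresholds\<close> lets \<open>a\<close> and
  \<open>b\<close> be exchanged by symmetry of paths alone.\<close>

lemma critical_spot_at_threshold:
  assumes card: "2 \<le> CARD('a)"
    and cover: "\<And>z. z \<in> side T a b \<or> z \<in> side T b a \<or> z \<in> \<langle>a, b\<rangle>"
    and lin: "\<And>P. P \<in> D \<Longrightarrow> linear_order P"
    and conn: "connected_graph (adjacency_graph D)"
    and sh: "\<And>P. P \<in> D \<Longrightarrow> semi_hybrid T a b P"
    and bad: "P \<in> D" "u \<in> side T a b" "z \<in> side T a b" "u \<in> \<langle>peak P, z\<rangle>" "(u, z) \<notin> P"
  shows "\<exists>x y. critical_spot D T x y \<and> x \<in> side T a b - {a} \<and> y \<in> side T a b - {a}"
proof (rule critical_spot_in_branch[OF card lin conn _ _ _ _ bad])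
  show "a \<in> side T a b"
    by (simp add: side_def)
  show "a \<in> \<langle>u, v\<rangle>" if "u \<in> side T a b" "v \<notin> side T a b" for u v
    using that tree_path_triangle[of u b v] by (auto simp: side_def)
  fix Q assume Q: "Q \<in> D"
  show "semi_single_peaked T a Q" if "peak Q \<in> side T a b - {a}"
    using sh[OF Q] that by (simp add: semi_hybrid_def)
  show "best Q (side T a b) = a" if "peak Q \<notin> side T a b - {a}"
    using sh[OF Q] that cover[of "peak Q"] endpoints_in_tree_path
    unfolding semi_hybrid_def by blast
qed

section \<open>The two equivalences\<close>

lemma not_single_peaked_iff_critical_spot:
  assumes card: "2 \<le> CARD('a)" and D: "semi_single_peaked_domain T D"
  shows "\<not> D \<subseteq> single_peaked_prefs T \<longleftrightarrow> (\<exists>x y. critical_spot D T x y)"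
proof
  from D obtain c where conn: "connected_graph (adjacency_graph D)"
    and lin: "\<And>P. P \<in> D \<Longrightarrow> linear_order P"
    and ssp: "\<And>P. P \<in> D \<Longrightarrow> semi_single_peaked T c P"
    unfolding semi_single_peaked_domain_def semi_single_peaked_prefs_def by blast
  {
    assume "\<not> D \<subseteq> single_peaked_prefs T"
    then obtain P u z where bad: "P \<in> D" "u \<in> \<langle>peak P, z\<rangle>" "(u, z) \<notin> P"
      using lin by (auto simp: single_peaked_prefs_def)
    \<comment> \<open>With \<open>B = UNIV\<close> a peak outside \<open>B - {c}\<close> is
      \<open>c\<close> itself, which is then best overall.\<close>
    have "best P UNIV = c" if "P \<in> D" "peak P \<notin> UNIV - {c}" for P
      using that best_eqI[OF lin] peak_best[OF lin] by (metis DiffI UNIV_I singletonD)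
    then show "\<exists>x y. critical_spot D T x y"
      using critical_spot_in_branch[OF card lin conn, of c UNIV P u z] ssp bad by blast
  }
  assume "\<exists>x y. critical_spot D T x y"
  then obtain x y P where "P \<in> D" "y \<noteq> x" "y \<in> \<langle>peak P, x\<rangle>" "(y, x) \<notin> P"
    using critical_spot_misordered lin by metis
  then show "\<not> D \<subseteq> single_peaked_prefs T"
    by (auto simp: single_peaked_prefs_def)
qed

lemma not_hybrid_iff_critical_spot:
  assumes card: "2 \<le> CARD('a)" and D: "semi_hybrid_domain T a b D"
  shows "\<not> D \<subseteq> hybrid_prefs T a b \<longleftrightarrow>
    (\<exists>x y. critical_spot D T x y \<and>
      ((x \<in> side T a b - {a} \<and> y \<in> side T a b - {a}) \<or>
       (x \<in> side T b a - {b} \<and> y \<in> side T b a - {b})))"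
    (is "_ \<longleftrightarrow> ?spot")
proof
  from D have dual: "dual_thresholds T a b" and conn: "connected_graph (adjacency_graph D)"
    and lin: "\<And>P. P \<in> D \<Longrightarrow> linear_order P"
    and sh: "\<And>P. P \<in> D \<Longrightarrow> semi_hybrid T a b P"
    unfolding semi_hybrid_domain_def semi_hybrid_prefs_def by blast+
  note cover = dual_thresholds_cover[OF dual]
  have cover': "z \<in> side T b a \<or> z \<in> side T a b \<or> z \<in> \<langle>b, a\<rangle>" for z
    using cover tree_path_sym by blast
  have sh': "\<And>P. P \<in> D \<Longrightarrow> semi_hybrid T b a P"
    using sh tree_path_sym by (auto simp: semi_hybrid_def)
  {
    assume "\<not> D \<subseteq> hybrid_prefs T a b"
    then obtain P where P: "P \<in> D" "P \<notin> hybrid_prefs T a b" by blast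
    have "best P \<langle>a, b\<rangle> = a" if "peak P \<in> side T a b - {a}"
      using semi_single_peaked_best_path[OF lin[OF P(1)]] sh[OF P(1)] that
      by (auto simp: semi_hybrid_def)
    moreover have "best P \<langle>a, b\<rangle> = b" if "peak P \<in> side T b a - {b}"
      using semi_single_peaked_best_path[OF lin[OF P(1)], of b a] sh[OF P(1)] that tree_path_sym
      by (auto simp: semi_hybrid_def)
    ultimately obtain u z where uz: "u \<in> \<langle>peak P, z\<rangle>" "(u, z) \<notin> P"
      and sides: "(u \<in> side T a b \<and> z \<in> side T a b) \<or> (u \<in> side T b a \<and> z \<in> side T b a)"
      using P lin[OF P(1)] unfolding hybrid_prefs_def by blast
    from sides show ?spot
    proof
      assume "u \<in> side T a b \<and> z \<in> side T a b"
      then show ?spot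
        using critical_spot_at_threshold[OF card cover lin conn sh P(1) _ _ uz] by blast
    next
      assume "u \<in> side T b a \<and> z \<in> side T b a"
      then show ?spot
        using critical_spot_at_threshold[OF card cover' lin conn sh' P(1) _ _ uz] by blast
    qed
  }
  assume ?spot
  then obtain x y where spot: "critical_spot D T x y"
    and xy: "(y \<in> side T a b \<and> x \<in> side T a b) \<or> (y \<in> side T b a \<and> x \<in> side T b a)"
    by blast
  obtain P where "P \<in> D" "y \<noteq> x" "y \<in> \<langle>peak P, x\<rangle>" "(y, x) \<notin> P"
    using critical_spot_misordered[OF spot lin] by metis
  with xy show "\<not> D \<subseteq> hybrid_prefs T a b"
    unfolding hybrid_prefs_def by blast
qed

end

theorem proposition1:
  assumes "3 \<le> CARD('a::finite)"
  shows "(\<forall>(T :: 'a graph) D. tree T \<longrightarrow> semi_single_peaked_domain T D \<longrightarrow>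
            (\<not> D \<subseteq> single_peaked_prefs T \<longleftrightarrow> (\<exists>x y. critical_spot D T x y))) \<and>
         (\<forall>(T :: 'a graph) a b D. tree T \<longrightarrow> semi_hybrid_domain T a b D \<longrightarrow>
            (\<not> D \<subseteq> hybrid_prefs T a b \<longleftrightarrow>
              (\<exists>x y. critical_spot D T x y \<and>
                 ((x \<in> side T a b - {a} \<and> y \<in> side T a b - {a}) \<or>
                  (x \<in> side T b a - {b} \<and> y \<in> side T b a - {b})))))"
proof -
  have card: "2 \<le> CARD('a)"
    using assms by simp
  show ?thesis
  proof (intro conjI allI impI)
    fix T :: "'a graph" and D
    assume "tree T" "semi_single_peaked_domain T D"
    then show "\<not> D \<subseteq> single_peaked_prefs T \<longleftrightarrow> (\<exists>x y. critical_spot D T x y)"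
      using finite_tree.not_single_peaked_iff_critical_spot[OF finite_tree.intro card] by blast
  next
    fix T :: "'a graph" and a b D
    assume "tree T" "semi_hybrid_domain T a b D"
    then show "\<not> D \<subseteq> hybrid_prefs T a b \<longleftrightarrow>
      (\<exists>x y. critical_spot D T x y \<and>
        ((x \<in> side T a b - {a} \<and> y \<in> side T a b - {a}) \<or>
         (x \<in> side T b a - {b} \<and> y \<in> side T b a - {b})))"
      by (rule finite_tree.not_hybrid_iff_critical_spot[OF finite_tree.intro card])
  qed
qed

end
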